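(* Let $X$ be a Radon plane and let $-\infty\le t\le 1$. Then $$C^B_t(X)\le\frac54.$$ Moreover, $$C^B_t(X)=\frac54\quad\Longleftrightarrow\quad S_X\text{ is an affine regular hexagon}.$$
   Context: $S_X$ denotes the unit sphere of $X$; spaces are real. For $x,y\in X$, Birkhoff-James orthogonality $x\perp_B y$ means $\|x+\lambda y\|\ge\|x\|$ for all $\lambda\in\mathbb{R}$. A Radon plane is a two-dimensional real normed space in which Birkhoff-James orthogonality is symmetric ($x\perp_B y$ implies $y\perp_B x$). $S_X$ is an affine regular hexagon if it is the image of (the boundary of) a regular Euclidean hexagon under an affine isomorphism; equivalently $S_X=\partial\operatorname{conv}\{\pm u,\pm v,\pm(u+v)\}$ for some linearly independent $u,v\in X$. For $a,b>0$ set $M_t(a,b)=\left(\frac{a^t+b^t}{2}\right)^{1/t}$ if $t\in\mathbb{R}\setminus\{0\}$, $M_0(a,b)=\sqrt{ab}$, and $M_{-\infty}(a,b)=\min\{a,b\}$. For $\tau\ge 0$ define $$J^B_{X,t}(\tau)=\sup\{M_t(\|x+\tau y\|,\|x-\tau y\|): x,y\in S_X,\ x\perp_B y\},\qquad C^B_t(X)=\sup_{0\le\tau\le1}\frac{J^B_{X,t}(\tau)^2}{1+\tau^2}.$$ *)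

theory Defs
  imports "HOL-Analysis.Analysis"
begin

definition bj_orthogonal :: "'a::real_normed_vector \<Rightarrow> 'a \<Rightarrow> bool" (infix "\<bottom>\<^sub>B" 50)
  where "x \<bottom>\<^sub>B y \<longleftrightarrow> (\<forall>l::real. norm (x + l *\<^sub>R y) \<ge> norm x)"

definition radon_plane :: "'a::real_normed_vector itself \<Rightarrow> bool"
  where "radon_plane _ \<longleftrightarrow>
    dim (UNIV :: 'a set) = 2 \<and> (\<forall>x y :: 'a. x \<bottom>\<^sub>B y \<longrightarrow> y \<bottom>\<^sub>B x)"

(* The sixth roots of unity span a regular hexagon in the Euclidean plane; every other regular
   hexagon arises from this one by a similarity. A map z \<mapsto> c + f z with f linear and
   bijective is the general affine isomorphism from the Euclidean plane onto the space. *)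
definition affine_regular_hexagon :: "'a::real_normed_vector set \<Rightarrow> bool"
  where "affine_regular_hexagon S \<longleftrightarrow>
    (\<exists>(f :: complex \<Rightarrow> 'a) c. linear f \<and> bij f \<and>
       S = (\<lambda>z. c + f z) ` frontier (convex hull {z. z ^ 6 = 1}))"

(* Meant for a, b > 0. The value max at t = \<infinity> is the usual convention. *)
definition power_mean :: "ereal \<Rightarrow> real \<Rightarrow> real \<Rightarrow> real"
  where "power_mean t a b =
    (if t = -\<infinity> then min a b
     else if t = \<infinity> then max a b
     else if t = 0 then sqrt (a * b)
     else ((a powr real_of_ereal t + b powr real_of_ereal t) / 2) powr (1 / real_of_ereal t))"

(* Both suprema are over bounded sets of reals: for unit vectors x, y with x \<bottom>\<^sub>B y one has
   1 \<le> norm (x \<plusminus> \<tau> y) \<le> 1 + \<tau>, so the arguments of the mean are positive.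
   The sets are nonempty as soon as the dimension is at least 2. *)
definition J_B :: "'a::real_normed_vector itself \<Rightarrow> ereal \<Rightarrow> real \<Rightarrow> real"
  where "J_B _ t \<tau> =
    Sup {power_mean t (norm (x + \<tau> *\<^sub>R y)) (norm (x - \<tau> *\<^sub>R y)) | x y :: 'a.
           x \<in> sphere 0 1 \<and> y \<in> sphere 0 1 \<and> x \<bottom>\<^sub>B y}"

definition C_B :: "'a::real_normed_vector itself \<Rightarrow> ereal \<Rightarrow> real"
  where "C_B X t = (SUP \<tau>\<in>{0..1}. (J_B X t \<tau>)\<^sup>2 / (1 + \<tau>\<^sup>2))"

end

theory Submission
  imports Defs
begin

text \<open>
  Let \<open>w\<close> be an area form on the plane. The Radon property says that the norm and the antinorm
  \<open>a \<mapsto> max {w a b | norm b = 1}\<close> have the same support directions, hence the same logarithmic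
  derivatives, so they are proportional; after rescaling \<open>w\<close> they coincide.

  Let \<open>x\<close>, \<open>y\<close> be orthogonal unit vectors with \<open>w x y = 1\<close>, and let \<open>z\<close>, \<open>v\<close> be unit vectors with
  \<open>w (x + y) z = norm (x + y)\<close> and \<open>w (x - y) v = norm (x - y)\<close>. With \<open>b = w x z\<close>, \<open>A = w y z\<close>,
  \<open>d = w x v\<close> and \<open>c = - w y v\<close>, all at most 1, one has \<open>norm (x + y) = b + A\<close>,
  \<open>norm (x - y) = c + d\<close> and
  \<open>1 \<ge> w v z = c * b + d * A = (b + A + c + d - 2) + (1 - c) * (1 - b) + (1 - d) * (1 - A)\<close>.
  Hence \<open>norm (x + y) + norm (x - y) \<le> 3\<close>, and in the case of equality both products vanish, which
  produces unit vectors \<open>p\<close>, \<open>q\<close>, \<open>p + q\<close> with \<open>w p q = 1\<close>, the vertices of a hexagonal unit sphere.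
  By convexity in \<open>\<tau>\<close> the arithmetic mean of \<open>norm (x \<plusminus> \<tau> y)\<close> is at most \<open>1 + \<tau> / 2\<close>, and
  \<open>(1 + \<tau> / 2)\<^sup>2 + (\<tau> - 1 / 2)\<^sup>2 = 5 / 4 * (1 + \<tau>\<^sup>2)\<close>. By compactness, the value \<open>5 / 4\<close> forces
  equality for some \<open>x\<close>, \<open>y\<close> and \<open>\<tau> = 1 / 2\<close>.
\<close>

section \<open>A vanishing-oscillation criterion on the unit interval\<close>

text \<open>Over \<open>n\<close> equal pieces of the interval the bounds telescope to
  \<open>K * (M 1 - M 0) / n\<close>, which tends to 0. This takes the place of a vanishing
  derivative when \<open>M\<close> is only a choice of subgradients.\<close>

lemma oscillation_zero_imp_equal_ends:
  fixes r M :: "real \<Rightarrow> real"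
  assumes osc: "\<And>s s'. 0 \<le> s \<Longrightarrow> s \<le> s' \<Longrightarrow> s' \<le> 1 \<Longrightarrow> \<bar>r s' - r s\<bar> \<le> K * (s' - s) * (M s' - M s)"
  shows "r 0 = r 1"
proof -
  have bound: "real (Suc n) * \<bar>r 1 - r 0\<bar> \<le> K * (M 1 - M 0)" for n
  proof -
    define p where "p i = real i / real (Suc n)" for i
    have p0: "p 0 = 0" and p1: "p (Suc n) = 1" by (auto simp: p_def)
    have d: "p (Suc i) - p i = 1 / real (Suc n)" for i
      by (simp add: p_def divide_simps)
    have "\<bar>r 1 - r 0\<bar> = \<bar>\<Sum>i<Suc n. r (p (Suc i)) - r (p i)\<bar>"
      by (subst sum_lessThan_telescope) (simp add: p0 p1)
    also have "\<dots> \<le> (\<Sum>i<Suc n. \<bar>r (p (Suc i)) - r (p i)\<bar>)"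
      by (rule sum_abs)
    also have "\<dots> \<le> (\<Sum>i<Suc n. K * (1 / real (Suc n)) * (M (p (Suc i)) - M (p i)))"
    proof (rule sum_mono)
      fix i assume "i \<in> {..<Suc n}"
      then have "0 \<le> p i" "p i \<le> p (Suc i)" "p (Suc i) \<le> 1"
        by (auto simp: p_def divide_simps)
      from osc[OF this] show "\<bar>r (p (Suc i)) - r (p i)\<bar> \<le> K * (1 / real (Suc n)) * (M (p (Suc i)) - M (p i))"
        by (simp only: d)
    qed
    also have "\<dots> = K * (1 / real (Suc n)) * (M 1 - M 0)"
      using sum_lessThan_telescope[of "\<lambda>i. M (p i)" "Suc n"]
      by (simp only: sum_distrib_left[symmetric] p0 p1)
    finally show ?thesis by (simp add: field_simps)
  qed
  show ?thesis
  proof (rule ccontr)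
    assume "r 0 \<noteq> r 1"
    then have pos: "\<bar>r 1 - r 0\<bar> > 0" by simp
    obtain n where "K * (M 1 - M 0) < real n * \<bar>r 1 - r 0\<bar>"
      using reals_Archimedean3[OF pos] by blast
    also have "\<dots> \<le> real (Suc n) * \<bar>r 1 - r 0\<bar>"
      by (intro mult_right_mono) auto
    finally show False using bound[of n] by simp
  qed
qed

section \<open>Linear coordinates on finite-dimensional normed spaces\<close>

lemma linear_bij_imp_inv_linear:
  fixes g :: "'e::real_vector \<Rightarrow> 'a::real_vector"
  assumes "linear g" "bij g"
  shows "linear (inv g)"
proof -
  have gi: "g (inv g z) = z" and ig: "inv g (g p) = p" for z p
    using assms(2) by (simp_all add: bij_is_surj surj_f_inv_f bij_is_inj)
  show ?thesis
  proof (rule linearI)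
    fix a b :: 'a and k :: real
    have "inv g (g (inv g a + inv g b)) = inv g (a + b)"
      using linear_add[OF assms(1)] by (simp only: gi)
    then show "inv g (a + b) = inv g a + inv g b" by (simp only: ig)
    have "inv g (g (k *\<^sub>R inv g a)) = inv g (k *\<^sub>R a)"
      using linear_scale[OF assms(1)] by (simp only: gi)
    then show "inv g (k *\<^sub>R a) = k *\<^sub>R inv g a" by (simp only: ig)
  qed
qed

text \<open>Equivalence of norms: \<open>norm (g p)\<close> has a positive minimum \<open>m\<close>
  on the compact Euclidean unit sphere, so by homogeneity \<open>1 / m\<close> bounds the
  inverse.\<close>

lemma linear_bij_euclidean_inv_bounded:
  fixes g :: "'e::euclidean_space \<Rightarrow> 'a::real_normed_vector"
  assumes g: "linear g" "bij g"
  shows "bounded_linear (inv g)"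
proof -
  have lin: "linear (inv g)"
    by (rule linear_bij_imp_inv_linear[OF g])
  have cont: "continuous_on S g" for S
    using g(1) by (simp add: linear_continuous_on linear_conv_bounded_linear)
  obtain m where m: "m > 0" "\<And>p. norm p = 1 \<Longrightarrow> m \<le> norm (g p)"
  proof -
    have "\<exists>x\<in>sphere (0::'e) 1. \<forall>y\<in>sphere 0 1. norm (g x) \<le> norm (g y)"
      by (rule continuous_attains_inf) (auto intro!: continuous_intros cont)
    then obtain x where x: "norm x = 1" "\<And>y. norm y = 1 \<Longrightarrow> norm (g x) \<le> norm (g y)"
      by auto
    have "g x \<noteq> 0"
      using x(1) g by (metis bij_is_inj injD linear_0 norm_zero zero_neq_one)
    with x that[of "norm (g x)"] show ?thesis by auto
  qed
  have "norm (inv g z) \<le> norm z * (1 / m)" for z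
  proof (cases "inv g z = 0")
    case False
    define p where "p = inv g z"
    have z: "z = g p" using g(2) by (simp add: p_def bij_is_surj surj_f_inv_f)
    have "m \<le> norm (g (p /\<^sub>R norm p))"
      using False by (intro m(2)) (simp add: p_def)
    also have "\<dots> = norm z / norm p"
      by (simp add: z linear_scale[OF g(1)] divide_inverse mult.commute)
    finally show ?thesis using False m(1) by (simp add: p_def[symmetric] field_simps)
  qed (use m(1) in simp)
  then show ?thesis
    using lin by (intro bounded_linear_intro[where K = "1 / m"]) (auto simp: linear_add linear_scale)
qed

text \<open>The sphere is the continuous image of its preimage \<open>P\<close>, which is closed
  and, as \<open>inv g\<close> is bounded, also bounded in a Euclidean space.\<close>

lemma linear_bij_euclidean_compact_sphere:
  fixes g :: "'e::euclidean_space \<Rightarrow> 'a::real_normed_vector"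
  assumes g: "linear g" "bij g"
  shows "compact (sphere (0::'a) 1)"
proof -
  interpret i: bounded_linear "inv g" by (rule linear_bij_euclidean_inv_bounded[OF g])
  have cont: "continuous_on S g" for S
    using g(1) by (simp add: linear_continuous_on linear_conv_bounded_linear)
  obtain B where B: "\<And>z. norm (inv g z) \<le> norm z * B" using i.bounded by blast
  define P where "P = {p. norm (g p) = 1}"
  have "closed P" unfolding P_def
    by (intro closed_Collect_eq continuous_intros cont)
  moreover have "norm p \<le> B" if "p \<in> P" for p
    using B[of "g p"] that g(2) by (simp add: P_def bij_is_inj)
  then have "bounded P" by (auto simp: bounded_iff)
  ultimately have "compact P" by (simp add: compact_eq_bounded_closed)
  then have "compact (g ` P)" by (intro compact_continuous_image cont)
  also have "g ` P = sphere 0 1"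
  proof (intro set_eqI iffI)
    fix z :: 'a assume "z \<in> sphere 0 1"
    then have "z = g (inv g z)" "inv g z \<in> P"
      using g(2) by (simp_all add: P_def bij_is_surj surj_f_inv_f)
    then show "z \<in> g ` P" by blast
  qed (auto simp: P_def)
  finally show ?thesis .
qed

lemma linear_bij_euclidean_continuous:
  fixes g :: "'e::euclidean_space \<Rightarrow> 'a::real_normed_vector" and h :: "'a \<Rightarrow> real"
  assumes g: "linear g" "bij g" and h: "linear h"
  shows "continuous_on S h"
proof -
  have "linear (\<lambda>p. h (g p))" using linear_compose[OF g(1) h] by (simp add: o_def)
  then have "bounded_linear (\<lambda>p. h (g p))" by (simp add: linear_conv_bounded_linear)
  from bounded_linear_compose[OF this linear_bij_euclidean_inv_bounded[OF g]]
  have "bounded_linear h"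
    using g(2) by (simp add: bij_is_surj surj_f_inv_f)
  then show ?thesis by (rule linear_continuous_on)
qed

text \<open>A basis of cardinality 2 is finite, and its two vectors serve as images of the standard
  basis.\<close>

lemma dim_2_coordinates:
  assumes "dim (UNIV :: 'a::real_vector set) = 2"
  obtains g :: "real \<times> real \<Rightarrow> 'a::real_vector" where "linear g" "bij g"
proof -
  obtain B :: "'a set" where B: "independent B" "UNIV \<subseteq> span B" "card B = 2"
    using basis_exists[of "UNIV :: 'a set"] assms by metis
  then obtain e f where ef: "B = {e, f}" "e \<noteq> f" by (auto simp: card_2_iff)
  define g :: "real \<times> real \<Rightarrow> 'a" where "g p = fst p *\<^sub>R e + snd p *\<^sub>R f" for p
  have lin: "linear g"
    by (rule linearI) (auto simp: g_def algebra_simps)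
  have "p = 0" if "g p = 0" for p
  proof -
    have ne: "f \<noteq> 0" "\<And>k. e \<noteq> k *\<^sub>R f"
      using B(1) ef by (auto simp: independent_insert span_singleton dependent_single split: if_splits)
    have *: "fst p = 0"
    proof (rule ccontr)
      assume "fst p \<noteq> 0"
      then have "e = (- snd p / fst p) *\<^sub>R f"
        using that by (simp add: g_def divide_simps vector_add_divide_simps eq_neg_iff_add_eq_0)
      with ne show False by blast
    qed
    with that ne show ?thesis by (simp add: g_def prod_eq_iff)
  qed
  then have "inj g" using lin by (simp add: linear_injective_0)
  moreover have "surj g"
  proof -
    have "\<exists>p. z = g p" for z
    proof -
      have "z \<in> span {e, f}" using B(2) ef by auto
      then obtain k where "z - k *\<^sub>R e \<in> span {f}" by (auto simp: span_insert)
      then obtain l where "z - k *\<^sub>R e = l *\<^sub>R f" by (auto simp: span_singleton)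
      then have "z = g (k, l)" by (simp add: g_def algebra_simps)
      then show ?thesis by blast
    qed
    then show ?thesis by (auto simp: surj_def)
  qed
  ultimately show ?thesis using that lin by (auto simp: bij_def)
qed

lemma bj_orthogonal_scaleR:
  assumes "a \<bottom>\<^sub>B b"
  shows "\<bar>k\<bar> * norm a \<le> norm (k *\<^sub>R a + l *\<^sub>R b)"
proof (cases "k = 0")
  case False
  have "k *\<^sub>R a + l *\<^sub>R b = k *\<^sub>R (a + (l / k) *\<^sub>R b)"
    using False by (simp add: algebra_simps)
  then have "norm (k *\<^sub>R a + l *\<^sub>R b) = \<bar>k\<bar> * norm (a + (l / k) *\<^sub>R b)" by simp
  moreover have "norm a \<le> norm (a + (l / k) *\<^sub>R b)"
    using assms by (simp add: bj_orthogonal_def)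
  ultimately show ?thesis by (simp add: mult_left_mono)
qed simp

section \<open>Area forms on the plane\<close>

text \<open>\<open>expand\<close> is Cramer's rule cleared of its denominator: if
  \<open>w a b\<close> is nonzero, it writes every \<open>c\<close> in the basis \<open>a\<close>,
  \<open>b\<close>. Two-dimensionality enters the later arguments in this form.\<close>

locale area_form =
  fixes w :: "'a::real_normed_vector \<Rightarrow> 'a \<Rightarrow> real"
  assumes bilinear: "bilinear w"
    and alternating [simp]: "w a a = 0"
    and expand: "w a b *\<^sub>R c = w c b *\<^sub>R a + w a c *\<^sub>R b"
begin

lemma w_simps:
  "w (a + b) c = w a c + w b c" "w c (a + b) = w c a + w c b"
  "w (a - b) c = w a c - w b c" "w c (a - b) = w c a - w c b"
  "w (k *\<^sub>R a) c = k * w a c" "w c (k *\<^sub>R a) = k * w c a"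
  "w (- a) c = - w a c" "w c (- a) = - w c a"
  using bilinear
  by (simp_all add: bilinear_ladd bilinear_radd bilinear_lsub bilinear_rsub bilinear_lmul
      bilinear_rmul bilinear_lneg bilinear_rneg)

lemma skew: "w a b = - w b a"
  using alternating[of "a + b"] unfolding w_simps(1)[of a b] w_simps(2)[of _ a b] by simp

end

text \<open>The determinant of the coordinates is such a form. Pairing \<open>a\<close> with its
  coordinate vector turned by a right angle gives a sum of squares, whence nondegeneracy.\<close>

lemma radon_plane_imp_area_form:
  assumes "radon_plane TYPE('a::real_normed_vector)"
  obtains w :: "'a::real_normed_vector \<Rightarrow> 'a \<Rightarrow> real" where "area_form w" "\<And>a. a \<noteq> 0 \<Longrightarrow> \<exists>b. w a b \<noteq> 0"
proof -
  obtain g :: "real \<times> real \<Rightarrow> 'a" where g: "linear g" "bij g"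
    using dim_2_coordinates assms unfolding radon_plane_def by blast
  define i where "i = inv g"
  have gi: "g (i z) = z" for z using g(2) by (simp add: i_def bij_is_surj surj_f_inv_f)
  have ig: "i (g p) = p" for p using g(2) by (simp add: i_def bij_is_inj)
  have i: "linear i" unfolding i_def by (rule linear_bij_imp_inv_linear[OF g])
  have inj: "i a = i b \<Longrightarrow> a = b" for a b using gi by metis
  define w where "w a b = fst (i a) * snd (i b) - snd (i a) * fst (i b)" for a b
  have "area_form w"
  proof
    show "bilinear w"
      unfolding bilinear_def w_def
      by (intro allI conjI linearI) (auto simp: linear_add[OF i] linear_scale[OF i] algebra_simps)
    show "w a a = 0" for a by (simp add: w_def)
    show "w a b *\<^sub>R c = w c b *\<^sub>R a + w a c *\<^sub>R b" for a b c
      by (rule inj, rule prod_eqI)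
        (simp_all add: linear_add[OF i] linear_diff[OF i] linear_scale[OF i] w_def algebra_simps)
  qed
  moreover have "\<exists>b. w a b \<noteq> 0" if "a \<noteq> 0" for a
  proof -
    have "i a \<noteq> 0" using that linear_0[OF g(1)] gi[of a] by auto
    then have "fst (i a) * fst (i a) + snd (i a) * snd (i a) \<noteq> 0"
      by (simp add: prod_eq_iff sum_squares_eq_zero_iff)
    then have "w a (g (- snd (i a), fst (i a))) \<noteq> 0" by (simp add: w_def ig)
    then show ?thesis by blast
  qed
  ultimately show ?thesis using that by blast
qed

lemma radon_plane_compact_sphere:
  assumes "radon_plane TYPE('a::real_normed_vector)"
  shows "compact (sphere (0::'a) 1)"
proof -
  obtain g :: "real \<times> real \<Rightarrow> 'a" where "linear g" "bij g"
    using dim_2_coordinates assms unfolding radon_plane_def by blast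
  then show ?thesis by (rule linear_bij_euclidean_compact_sphere)
qed

lemma radon_plane_linear_continuous:
  fixes h :: "'a::real_normed_vector \<Rightarrow> real"
  assumes "radon_plane TYPE('a)" "linear h"
  shows "continuous_on S h"
proof -
  obtain g :: "real \<times> real \<Rightarrow> 'a" where "linear g" "bij g"
    using dim_2_coordinates assms unfolding radon_plane_def by blast
  then show ?thesis using assms(2) by (rule linear_bij_euclidean_continuous)
qed

section \<open>The hexagonal norm and the regular hexagon\<close>

text \<open>The norm whose unit ball is the hexagon with vertices (1,0), (1,1), (0,1) and their
  negatives; each absolute value accounts for one pair of parallel sides.\<close>

definition hexnorm :: "real \<Rightarrow> real \<Rightarrow> real"
  where "hexnorm a b = max \<bar>a\<bar> (max \<bar>b\<bar> \<bar>a - b\<bar>)"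

text \<open>The vertices cut the plane into six cones. On the cone between two consecutive vertices
  the norm is linear, equal to the sum of the coefficients.\<close>

lemma hexnorm_decompose:
  obtains s t p1 p2 q1 q2 where "0 \<le> s" "0 \<le> t" "s + t = hexnorm a b"
    "a = s * p1 + t * q1" "b = s * p2 + t * q2"
    "(p1, p2) \<in> {(1, 0), (0, 1), (1, 1), (-1, 0), (0, -1), (-1, -1)}"
    "(q1, q2) \<in> {(1, 0), (0, 1), (1, 1), (-1, 0), (0, -1), (-1, -1)}"
proof -
  consider "0 \<le> b" "b \<le> a" | "0 \<le> a" "a \<le> b" | "a \<le> 0" "0 \<le> b"
    | "0 \<le> a" "b \<le> 0" | "a \<le> b" "b \<le> 0" | "b \<le> a" "a \<le> 0" by linarith
  then show ?thesis
  proof cases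
    case 1 then show ?thesis by (intro that[of b "a - b" 1 1 1 0]) (auto simp: hexnorm_def)
  next
    case 2 then show ?thesis by (intro that[of a "b - a" 1 0 1 1]) (auto simp: hexnorm_def)
  next
    case 3 then show ?thesis by (intro that[of "- a" b "-1" 0 0 1]) (auto simp: hexnorm_def)
  next
    case 4 then show ?thesis by (intro that[of a "- b" 1 0 0 "-1"]) (auto simp: hexnorm_def)
  next
    case 5 then show ?thesis by (intro that[of "- b" "b - a" "-1" "-1" "-1" 0]) (auto simp: hexnorm_def)
  next
    case 6 then show ?thesis by (intro that[of "- a" "a - b" "-1" 0 "-1" "-1"]) (auto simp: hexnorm_def)
  qed
qed

lemma hexnorm_scale: "hexnorm (k * a) (k * b) = \<bar>k\<bar> * hexnorm a b"
proof -
  have "\<bar>k * a - k * b\<bar> = \<bar>k\<bar> * \<bar>a - b\<bar>"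
    by (simp flip: abs_mult right_diff_distrib)
  then show ?thesis by (simp add: hexnorm_def abs_mult max_mult_distrib_left)
qed

text \<open>Coordinates of the complex plane with respect to the basis \<open>1\<close>, \<open>\<omega>\<^sup>2\<close>, where \<open>\<omega>\<close> is the
  primitive sixth root of unity \<open>hex_point 1 1\<close>.\<close>
definition hex_fst :: "complex \<Rightarrow> real" where "hex_fst z = Re z + Im z / sqrt 3"
definition hex_snd :: "complex \<Rightarrow> real" where "hex_snd z = 2 * Im z / sqrt 3"
definition hex_point :: "real \<Rightarrow> real \<Rightarrow> complex"
  where "hex_point a b = Complex (a - b / 2) (sqrt 3 / 2 * b)"

lemma hex_point_simps [simp]:
  "hex_fst (hex_point a b) = a" "hex_snd (hex_point a b) = b"
  "hex_point (hex_fst z) (hex_snd z) = z"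
  by (simp_all add: hex_fst_def hex_snd_def hex_point_def complex_eq_iff)

lemma hex_point_linear:
  "hex_point (a + c) (b + d) = hex_point a b + hex_point c d"
  "hex_point (k * a) (k * b) = k *\<^sub>R hex_point a b"
  by (simp_all add: hex_point_def complex_eq_iff field_simps)

lemma linear_hex_coordinates: "linear hex_fst" "linear hex_snd"
  by (intro linearI; simp add: hex_fst_def hex_snd_def field_simps)+

lemma sixth_roots_of_unity:
  "{z :: complex. z ^ 6 = 1} = (\<lambda>(a, b). hex_point a b) ` {(1, 0), (0, 1), (1, 1), (-1, 0), (0, -1), (-1, -1)}"
proof -
  let ?h = "hex_point 1 1"
  \<comment> \<open>The quadratic equation of a primitive sixth root of unity; the powers and the
    factorisation of \<open>z ^ 6 - 1\<close> below follow from it.\<close>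
  have h: "?h * ?h = ?h - 1"
    by (simp add: hex_point_def complex_eq_iff field_simps)
  have vertices: "hex_point 1 0 = 1" "hex_point (-1) 0 = -1" "hex_point 0 1 = ?h - 1"
    "hex_point (-1) (-1) = - ?h" "hex_point 0 (-1) = 1 - ?h"
    by (simp_all add: hex_point_def complex_eq_iff)
  have "?h ^ 6 = 1" "(- ?h) ^ 6 = 1" "(?h - 1) ^ 6 = 1" "(1 - ?h) ^ 6 = 1"
    using h by algebra+
  moreover have "(-1 :: complex) ^ 6 = 1" by simp
  moreover have "z \<in> {1, -1, ?h - 1, - ?h, ?h, 1 - ?h}" if "z ^ 6 = 1" for z
  proof -
    have "(z - 1) * (z + 1) * (z - (?h - 1)) * (z + ?h) * (z - ?h) * (z - (1 - ?h)) = z ^ 6 - 1"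
      using h by algebra
    with that show ?thesis by (auto simp: eq_neg_iff_add_eq_0)
  qed
  ultimately have "{z. z ^ 6 = 1} = {1, -1, ?h - 1, - ?h, ?h, 1 - ?h}" by auto
  then show ?thesis by (auto simp: vertices)
qed

text \<open>The ball is an intersection of three strips, hence convex, and contains the vertices.
  Conversely, a point of it is a combination of two vertices and the origin.\<close>

lemma hexagon_hull:
  "convex hull {z :: complex. z ^ 6 = 1} = {z. hexnorm (hex_fst z) (hex_snd z) \<le> 1}"
    (is "convex hull ?R = ?H")
proof
  have "?H = hex_fst -` {-1..1} \<inter> hex_snd -` {-1..1} \<inter> (\<lambda>z. hex_fst z - hex_snd z) -` {-1..1}"
    by (auto simp: hexnorm_def abs_le_iff)
  moreover have "linear (\<lambda>z. hex_fst z - hex_snd z)"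
    by (intro linear_compose_sub linear_hex_coordinates)
  ultimately have "convex ?H"
    using linear_hex_coordinates by (auto intro!: convex_Int convex_linear_vimage)
  then show "convex hull ?R \<subseteq> ?H"
    by (rule hull_minimal[rotated]) (auto simp: sixth_roots_of_unity hexnorm_def)
next
  show "?H \<subseteq> convex hull ?R"
  proof
    fix z assume z: "z \<in> ?H"
    let ?V = "{(1, 0), (0, 1), (1, 1), (-1, 0), (0, -1), (-1, -1)} :: (real \<times> real) set"
    obtain s t p1 p2 q1 q2 where *: "0 \<le> s" "0 \<le> t" "s + t = hexnorm (hex_fst z) (hex_snd z)"
      "hex_fst z = s * p1 + t * q1" "hex_snd z = s * p2 + t * q2"
      and pq: "(p1, p2) \<in> ?V" "(q1, q2) \<in> ?V"
      by (rule hexnorm_decompose)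
    have nonneg: "0 \<le> s" "0 \<le> t" "s + t \<le> 1" using *(1-3) z by auto
    have in_hull: "hex_point a b \<in> convex hull ?R" if "(a, b) \<in> ?V" for a b
      unfolding sixth_roots_of_unity using that by (intro hull_inc image_eqI[of _ _ "(a, b)"]) auto
    have "hex_point 1 0 \<in> convex hull ?R" "hex_point (-1) 0 \<in> convex hull ?R"
      by (rule in_hull; simp)+
    then have "(1/2) *\<^sub>R hex_point 1 0 + (1/2) *\<^sub>R hex_point (-1) 0 \<in> convex hull ?R"
      by (intro convexD[OF convex_convex_hull]) auto
    also have "(1/2) *\<^sub>R hex_point 1 0 + (1/2) *\<^sub>R hex_point (-1) 0 = 0"
      by (simp add: hex_point_def complex_eq_iff)
    finally have zero: "0 \<in> convex hull ?R" .
    have "z = hex_point (s * p1 + t * q1) (s * p2 + t * q2)"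
      by (simp flip: *(4,5))
    then have z_eq: "z = s *\<^sub>R hex_point p1 p2 + t *\<^sub>R hex_point q1 q2"
      by (simp add: hex_point_linear)
    show "z \<in> convex hull ?R"
    proof (cases "s + t = 0")
      case True
      with nonneg zero z_eq show ?thesis by (simp add: add_nonneg_eq_0_iff)
    next
      case False
      \<comment> \<open>The radial projection of \<open>z\<close> to the boundary; \<open>z\<close>
        lies between it and the origin.\<close>
      define y where "y = (s / (s + t)) *\<^sub>R hex_point p1 p2 + (t / (s + t)) *\<^sub>R hex_point q1 q2"
      have "y \<in> convex hull ?R"
        unfolding y_def using nonneg False
        by (intro convexD[OF convex_convex_hull in_hull[OF pq(1)] in_hull[OF pq(2)]])
          (simp_all flip: add_divide_distrib)
      then have "(s + t) *\<^sub>R y + (1 - (s + t)) *\<^sub>R 0 \<in> convex hull ?R"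
        by (rule convexD[OF convex_convex_hull _ zero]) (use nonneg in simp_all)
      then show ?thesis using False by (simp add: y_def z_eq scaleR_add_right)
    qed
  qed
qed

lemma hexagon_frontier:
  "frontier (convex hull {z :: complex. z ^ 6 = 1}) = {z. hexnorm (hex_fst z) (hex_snd z) = 1}"
proof -
  let ?n = "\<lambda>z. hexnorm (hex_fst z) (hex_snd z)"
  have cont: "continuous_on UNIV ?n"
    unfolding hexnorm_def hex_fst_def hex_snd_def by (intro continuous_intros) auto
  have "closed {z. ?n z \<le> 1}" by (intro closed_Collect_le cont) auto
  moreover have "interior {z. ?n z \<le> 1} = {z. ?n z < 1}"
  proof (intro antisym subsetI)
    fix z assume z: "z \<in> interior {z. ?n z \<le> 1}"
    then obtain e where e: "e > 0" "ball z e \<subseteq> {z. ?n z \<le> 1}" by (auto simp: mem_interior)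
    \<comment> \<open>Dilating by \<open>1 + d\<close> moves \<open>z\<close> by at most
      \<open>e / 2\<close>, so the dilated point still has hexagonal norm at most 1. The summand 1
      covers \<open>z = 0\<close>.\<close>
    define d where "d = e / (2 * (norm z + 1))"
    have d: "d > 0" using e(1) by (simp add: d_def add_nonneg_pos)
    have "d * norm z = e / 2 * (norm z / (norm z + 1))" by (simp add: d_def)
    also have "\<dots> \<le> e / 2 * 1"
      using e(1) by (intro mult_left_mono) (auto simp: divide_le_eq_1 add_nonneg_pos)
    finally have "d * norm z < e" using e(1) by simp
    then have "z + d *\<^sub>R z \<in> ball z e" using d by (simp add: dist_norm)
    then have "?n ((1 + d) *\<^sub>R z) \<le> 1" using e by (auto simp: scaleR_add_left)
    then have "(1 + d) * ?n z \<le> 1"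
      using d by (simp add: linear_scale[OF linear_hex_coordinates(1)]
          linear_scale[OF linear_hex_coordinates(2)] hexnorm_scale)
    then have "?n z \<le> 1 / (1 + d)" using d by (simp add: field_simps)
    also have "\<dots> < 1" using d by simp
    finally show "z \<in> {z. ?n z < 1}" by simp
  next
    fix z assume "z \<in> {z. ?n z < 1}"
    moreover have "open {z. ?n z < 1}" by (intro open_Collect_less cont) auto
    ultimately show "z \<in> interior {z. ?n z \<le> 1}" by (auto intro!: interiorI[of "{z. ?n z < 1}"])
  qed
  ultimately show ?thesis by (auto simp: hexagon_hull frontier_def)
qed

lemma hexagonal_norm_imp_affine_regular_hexagon:
  fixes u v :: "'a::real_normed_vector"
  assumes norm: "\<And>a b. norm (a *\<^sub>R u + b *\<^sub>R v) = hexnorm a b"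
    and span: "\<And>z. \<exists>a b. z = a *\<^sub>R u + b *\<^sub>R v"
  shows "affine_regular_hexagon (sphere (0::'a) 1)"
proof -
  define f where "f z = hex_fst z *\<^sub>R u + hex_snd z *\<^sub>R v" for z
  have f_point: "f (hex_point a b) = a *\<^sub>R u + b *\<^sub>R v" for a b by (simp add: f_def)
  have lin: "linear f"
    by (rule linearI) (simp_all add: f_def linear_add[OF linear_hex_coordinates(1)]
        linear_add[OF linear_hex_coordinates(2)] linear_scale[OF linear_hex_coordinates(1)]
        linear_scale[OF linear_hex_coordinates(2)] algebra_simps)
  have nf: "norm (f z) = hexnorm (hex_fst z) (hex_snd z)" for z by (simp add: f_def norm)
  have "z = 0" if "f z = 0" for z
  proof -
    have "hexnorm (hex_fst z) (hex_snd z) = 0" using nf[of z] that by simp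
    then have "hex_fst z = 0" "hex_snd z = 0" by (auto simp: hexnorm_def max_def split: if_splits)
    then have "z = hex_point 0 0" by (metis hex_point_simps(3))
    then show ?thesis by (simp add: hex_point_def complex_eq_iff)
  qed
  then have "inj f" using lin by (simp add: linear_injective_0)
  moreover have "surj f" using span f_point by (metis surj_def)
  ultimately have bij: "bij f" by (simp add: bij_def)
  have "sphere 0 1 = (\<lambda>z. 0 + f z) ` {z. hexnorm (hex_fst z) (hex_snd z) = 1}"
    using \<open>surj f\<close> by (auto simp: nf[symmetric] surj_def image_iff) metis
  with lin bij show ?thesis unfolding affine_regular_hexagon_def hexagon_frontier by blast
qed

text \<open>The centre \<open>c\<close> must be the origin, since a bounded set has no nontrivial
  translation into itself. Then \<open>f\<close> matches the two unit spheres, and homogeneity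
  matches the norms.\<close>

lemma affine_regular_hexagon_imp_hexagonal_norm:
  assumes "affine_regular_hexagon (sphere (0::'a::real_normed_vector) 1)"
  obtains u v :: "'a::real_normed_vector" where "\<And>a b. norm (a *\<^sub>R u + b *\<^sub>R v) = hexnorm a b"
proof -
  let ?n = "\<lambda>z. hexnorm (hex_fst z) (hex_snd z)"
  obtain f :: "complex \<Rightarrow> 'a" and c where f: "linear f" "bij f"
    and S: "sphere 0 1 = (\<lambda>z. c + f z) ` {z. ?n z = 1}"
    using assms unfolding affine_regular_hexagon_def hexagon_frontier by blast
  have neg: "?n (- z) = ?n z" for z
    using hexnorm_scale[of "-1" "hex_fst z" "hex_snd z"]
    by (simp add: linear_neg[OF linear_hex_coordinates(1)] linear_neg[OF linear_hex_coordinates(2)])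
  \<comment> \<open>Reflecting the sphere in the origin and then the hexagon in its own centre
    composes to a translation by twice \<open>c\<close>.\<close>
  have step: "\<exists>z'. ?n z' = 1 \<and> f z' = f z + 2 *\<^sub>R c" if "?n z = 1" for z
  proof -
    have "c + f z \<in> sphere 0 1" using that S by blast
    then have "- (c + f z) \<in> sphere 0 1" by (simp add: norm_minus_commute flip: norm_minus_cancel[of "c + f z"])
    then obtain z' where z': "?n z' = 1" "- (c + f z) = c + f z'" using S by auto
    then have "f z' = - (c + f z) - c" by simp
    with z'(1) show ?thesis
      by (intro exI[of _ "- z'"]) (auto simp: neg linear_neg[OF f(1)] scaleR_2)
  qed
  have far: "\<exists>z. ?n z = 1 \<and> f z = f (hex_point 1 0) + real n *\<^sub>R (2 *\<^sub>R c)" for n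
  proof (induction n)
    case 0 then show ?case by (intro exI[of _ "hex_point 1 0"]) (simp add: hexnorm_def)
  next
    case (Suc n) then show ?case using step by (fastforce simp: algebra_simps)
  qed
  have "c = 0"
  proof (rule ccontr)
    assume "c \<noteq> 0"
    then have "0 < norm (2 *\<^sub>R c)" by simp
    then obtain n where n: "1 + norm (c + f (hex_point 1 0)) < real n * norm (2 *\<^sub>R c)"
      using reals_Archimedean3 by blast
    obtain z where z: "?n z = 1" "f z = f (hex_point 1 0) + real n *\<^sub>R (2 *\<^sub>R c)" using far by blast
    then have "c + f z \<in> sphere 0 1" using S by blast
    then have "norm (c + f z) = 1" by simp
    have "norm (real n *\<^sub>R (2 *\<^sub>R c)) = norm ((c + f z) - (c + f (hex_point 1 0)))" by (simp add: z)
    also have "\<dots> \<le> norm (c + f z) + norm (c + f (hex_point 1 0))" by (rule norm_triangle_ineq4)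
    finally show False using n \<open>norm (c + f z) = 1\<close> by simp
  qed
  have nf: "norm (f z) = ?n z" for z
  proof (cases "?n z = 0")
    case True
    then have "hex_fst z = 0" "hex_snd z = 0" by (auto simp: hexnorm_def max_def split: if_splits)
    then have "z = hex_point 0 0" by (metis hex_point_simps(3))
    then have "z = 0" by (simp add: hex_point_def complex_eq_iff)
    then show ?thesis using True by (simp add: linear_0[OF f(1)])
  next
    case False
    then have pos: "?n z > 0" by (auto simp: hexnorm_def less_max_iff_disj)
    then have "?n (z /\<^sub>R ?n z) = 1"
      by (simp add: linear_scale[OF linear_hex_coordinates(1)]
          linear_scale[OF linear_hex_coordinates(2)] hexnorm_scale)
    then have "f (z /\<^sub>R ?n z) \<in> sphere 0 1" using S \<open>c = 0\<close> by force
    then show ?thesis using pos by (simp add: linear_scale[OF f(1)] field_simps)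
  qed
  have "norm (a *\<^sub>R f (hex_point 1 0) + b *\<^sub>R f (hex_point 0 1)) = hexnorm a b" for a b
  proof -
    have "a *\<^sub>R f (hex_point 1 0) + b *\<^sub>R f (hex_point 0 1) = f (hex_point a b)"
      by (simp flip: linear_scale[OF f(1)] linear_add[OF f(1)] hex_point_linear)
    then show ?thesis by (simp add: nf)
  qed
  then show ?thesis by (rule that)
qed

section \<open>Power means\<close>

lemma power_mean_nonneg:
  assumes "0 \<le> a" "0 \<le> b"
  shows "0 \<le> power_mean t a b"
  using assms by (auto simp: power_mean_def)

lemma power_mean_same:
  assumes "0 < a"
  shows "power_mean t a a = a"
  using assms by (cases t) (auto simp: power_mean_def powr_powr)

lemma power_mean_le_arith_mean:
  assumes "0 < a" "0 < b" "t \<le> 1"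
  shows "power_mean t a b \<le> (a + b) / 2"
proof (cases t)
  case MInf
  then show ?thesis by (auto simp: power_mean_def)
next
  case PInf
  with assms show ?thesis by simp
next
  case (real r)
  define m where "m = (a + b) / 2"
  have m: "m > 0" using assms by (simp add: m_def)
  consider "r = 0" | "r < 0" | "0 < r" "r \<le> 1" using assms real by fastforce
  then show ?thesis
  proof cases
    case 1
    then show ?thesis using real arith_geo_mean_sqrt[of a b] assms by (simp add: power_mean_def)
  next
    case 2
    \<comment> \<open>For negative \<open>r\<close> the geometric mean is interposed: AM-GM applied
      to the powers, reversed by the decreasing map with exponent \<open>1 / r\<close>, and AM-GM
      once more.\<close>
    have "(sqrt (a * b)) powr r = sqrt (a powr r * b powr r)"
      using assms by (simp add: powr_mult powr_half_sqrt[symmetric] powr_powr mult.commute)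
    also have "\<dots> \<le> (a powr r + b powr r) / 2" by (intro arith_geo_mean_sqrt) auto
    finally have "((a powr r + b powr r) / 2) powr (1 / r) \<le> ((sqrt (a * b)) powr r) powr (1 / r)"
      using 2 assms by (intro powr_mono2') auto
    also have "\<dots> = sqrt (a * b)" using 2 assms by (simp add: powr_powr)
    also have "\<dots> \<le> (a + b) / 2" using assms by (intro arith_geo_mean_sqrt) auto
    finally show ?thesis using real 2 by (simp add: power_mean_def)
  next
    case 3
    \<comment> \<open>The concave power lies below its tangent at 1. After scaling by
      \<open>m\<close>, the tangent bounds for \<open>a\<close> and \<open>b\<close> add up to
      exactly 2.\<close>
    have young: "(c / m) powr r \<le> r * (c / m) + (1 - r)" if "c > 0" for c
      using Youngs_inequality_0[of r "1 - r" "c / m" 1] 3 that m by auto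
    have "(a / m) powr r + (b / m) powr r \<le> r * (a / m + b / m) + 2 * (1 - r)"
      using young[of a] young[of b] assms by (simp add: algebra_simps)
    also have "a / m + b / m = 2" using m unfolding m_def by (subst add_divide_distrib[symmetric]) (simp add: divide_eq_eq)
    finally have "(a powr r + b powr r) / m powr r \<le> 2"
      using m assms by (simp add: powr_divide add_divide_distrib)
    then have "(a powr r + b powr r) / 2 \<le> m powr r" using m by (simp add: field_simps)
    then have "((a powr r + b powr r) / 2) powr (1 / r) \<le> (m powr r) powr (1 / r)"
      using 3 by (intro powr_mono2) auto
    also have "\<dots> = m" using 3 m by (simp add: powr_powr)
    finally show ?thesis using real 3 by (simp add: power_mean_def m_def)
  qed
qed

section \<open>Proportionality of norm and antinorm\<close>

text \<open>\<open>B a\<close> maximises \<open>w a\<close> on the unit sphere, so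
  \<open>w a (B a)\<close> is the antinorm. By the Radon property the functional
  \<open>\<lambda>c. w c (B a)\<close> supports, up to scaling, both norms at \<open>a\<close>; so
  their ratio cannot change along a segment that avoids the origin.\<close>

lemma radon_antinorm_proportional:
  fixes w :: "'a::real_normed_vector \<Rightarrow> 'a \<Rightarrow> real" and B :: "'a \<Rightarrow> 'a"
  assumes radon: "radon_plane TYPE('a)" and "area_form w"
    and nondeg: "\<And>a. a \<noteq> 0 \<Longrightarrow> \<exists>b. w a b \<noteq> 0"
    and B: "\<And>a. norm (B a) = 1" "\<And>a c. w a c \<le> w a (B a) * norm c"
    and a: "a \<noteq> 0" and c: "c \<noteq> 0"
  shows "w a (B a) / norm a = w c (B c) / norm c"
proof -
  interpret area_form w by fact
  define A where "A a = w a (B a)" for a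
  have A_ge: "w a c \<le> A a * norm c" for a c using B(2) by (simp add: A_def)
  have A_pos: "A a > 0" if "a \<noteq> 0" for a
  proof -
    from nondeg[OF that] obtain b where "w a b \<noteq> 0" by blast
    then have "0 < w a b \<or> 0 < w a (- b)" by (auto simp: w_simps)
    then have "0 < A a * norm b" using A_ge[of a b] A_ge[of a "- b"] by auto
    then show ?thesis by (simp add: zero_less_mult_iff not_less[symmetric])
  qed
  \<comment> \<open>Adding multiples of \<open>a\<close> to \<open>B a\<close> leaves
    \<open>w a\<close> unchanged, so maximality makes \<open>B a\<close> orthogonal to
    \<open>a\<close>; symmetry reverses this.\<close>
  have orth: "a \<bottom>\<^sub>B B a" if "a \<noteq> 0" for a
  proof -
    have "norm (B a) \<le> norm (B a + l *\<^sub>R a)" for l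
    proof -
      have "A a * 1 \<le> A a * norm (B a + l *\<^sub>R a)"
        using A_ge[of a "B a + l *\<^sub>R a"] by (simp add: w_simps A_def)
      then show ?thesis using A_pos[OF that] B(1) by simp
    qed
    then show ?thesis using radon unfolding radon_plane_def bj_orthogonal_def by blast
  qed
  have support_A: "w c (B a) \<le> A c" for a c using A_ge[of c "B a"] B(1) by simp
  have support_norm: "w c (B a) * norm a \<le> A a * norm c" if "a \<noteq> 0" for a c
  proof -
    have "w c (B a) * norm a \<le> \<bar>w c (B a)\<bar> * norm a"
      by (intro mult_right_mono) auto
    also have "\<dots> \<le> norm (w c (B a) *\<^sub>R a + w a c *\<^sub>R B a)"
      by (rule bj_orthogonal_scaleR[OF orth[OF that]])
    also have "\<dots> = norm (A a *\<^sub>R c)" by (simp add: A_def expand[of a "B a" c])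
    also have "\<dots> = A a * norm c" using A_pos[OF that] by simp
    finally show ?thesis .
  qed
  have segment: "A a / norm a = A c / norm c" if nz: "\<And>s. 0 \<le> s \<Longrightarrow> s \<le> 1 \<Longrightarrow> a + s *\<^sub>R (c - a) \<noteq> 0" for a c
  proof -
    define y where "y = c - a"
    define z where "z s = a + s *\<^sub>R y" for s
    \<comment> \<open>\<open>M\<close> is a subgradient of the convex function \<open>A (z s)\<close>, and by the Radon property
      \<open>M s * norm (z s) / A (z s)\<close> is one of \<open>norm (z s)\<close>.\<close>
    define M where "M s = w y (B (z s))" for s
    have z: "z s \<noteq> 0" if "0 \<le> s" "s \<le> 1" for s using nz[OF that] by (simp add: z_def y_def)
    have wz: "w (z s') (B (z s)) = A (z s) + (s' - s) * M s" for s s'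
      by (simp add: A_def M_def z_def w_simps algebra_simps)
    \<comment> \<open>The least norm on the segment is a positive lower bound for the
      denominators.\<close>
    have "\<exists>x\<in>{0..1}. \<forall>s\<in>{0..1}. norm (z x) \<le> norm (z s)"
      unfolding z_def by (rule continuous_attains_inf) (auto intro!: continuous_intros)
    then obtain x where x: "0 \<le> x" "x \<le> 1" "\<And>s. 0 \<le> s \<Longrightarrow> s \<le> 1 \<Longrightarrow> norm (z x) \<le> norm (z s)"
      by auto
    define m where "m = norm (z x)"
    have m: "m > 0" using z x by (simp add: m_def)
    \<comment> \<open>The support inequality for the norm is used at \<open>s\<close>, that for
      \<open>A\<close> at \<open>s'\<close>. The bound is symmetric in \<open>s\<close> and
      \<open>s'\<close>, so exchanging them bounds the absolute value.\<close>
    have up: "A (z s') / norm (z s') - A (z s) / norm (z s) \<le> (s' - s) * (M s' - M s) / m"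
      if s: "0 \<le> s" "s \<le> 1" "0 \<le> s'" "s' \<le> 1" for s s'
    proof -
      have A1: "A (z s) \<ge> A (z s') + (s - s') * M s'" and A2: "A (z s') \<ge> A (z s) + (s' - s) * M s"
        using support_A[of "z s" "z s'"] support_A[of "z s'" "z s"] by (simp_all add: wz)
      have n: "(A (z s) + (s' - s) * M s) * norm (z s) \<le> A (z s) * norm (z s')"
        using support_norm[OF z[OF s(1,2)], of "z s'"] by (simp add: wz)
      have pos: "norm (z s) > 0" "norm (z s') > 0" using z s by auto
      have mono: "0 \<le> (s' - s) * (M s' - M s)" using A1 A2 by (simp add: algebra_simps)
      have "A (z s') * norm (z s) - A (z s) * norm (z s')
          \<le> (A (z s') - A (z s) - (s' - s) * M s) * norm (z s)"
        using n by (simp add: algebra_simps)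
      also have "\<dots> \<le> (s' - s) * (M s' - M s) * norm (z s)"
        using A1 by (intro mult_right_mono) (auto simp: algebra_simps)
      finally have "(A (z s') * norm (z s) - A (z s) * norm (z s')) / (norm (z s) * norm (z s'))
         \<le> (s' - s) * (M s' - M s) * norm (z s) / (norm (z s) * norm (z s'))"
        using pos by (intro divide_right_mono) auto
      also have "\<dots> = (s' - s) * (M s' - M s) / norm (z s')" using pos by simp
      also have "\<dots> \<le> (s' - s) * (M s' - M s) / m"
        using x(3)[of s'] s m mono pos by (intro divide_left_mono) (auto simp: m_def)
      finally show ?thesis using pos by (simp add: diff_divide_distrib)
    qed
    have "A (z 0) / norm (z 0) = A (z 1) / norm (z 1)"
    proof (rule oscillation_zero_imp_equal_ends[where r = "\<lambda>s. A (z s) / norm (z s)" and M = M and K = "1 / m"])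
      fix s s' :: real assume "0 \<le> s" "s \<le> s'" "s' \<le> 1"
      then show "\<bar>A (z s') / norm (z s') - A (z s) / norm (z s)\<bar> \<le> 1 / m * (s' - s) * (M s' - M s)"
        using up[of s s'] up[of s' s] minus_mult_minus[of "s' - s" "M s' - M s"]
        by (simp add: abs_le_iff)
    qed
    then show ?thesis by (simp add: z_def y_def)
  qed
  have indep: "A a / norm a = A c / norm c" if "w a c \<noteq> 0" for a c
  proof (rule segment)
    fix s assume "0 \<le> s" "s \<le> (1::real)"
    have "w a (a + s *\<^sub>R (c - a)) = s * w a c" "w (a + s *\<^sub>R (c - a)) c = (1 - s) * w a c"
      by (simp_all add: w_simps algebra_simps)
    with that show "a + s *\<^sub>R (c - a) \<noteq> 0"
      using w_simps(5)[of 0 0 c] w_simps(6)[of a 0 0] by (cases "s = 0") auto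
  qed
  show ?thesis
  proof (cases "w a c = 0")
    case True
    \<comment> \<open>For parallel \<open>a\<close> and \<open>c\<close> the segment may meet the
      origin; both are compared with a third direction instead.\<close>
    obtain b where b: "w a b \<noteq> 0" using nondeg a by blast
    have "w c b *\<^sub>R a = w a b *\<^sub>R c" using expand[of a b c] True by simp
    with b c have "w c b \<noteq> 0" by auto
    with indep b show ?thesis by (metis A_def)
  qed (use indep in \<open>auto simp: A_def\<close>)
qed

section \<open>Area forms normalised to the norm\<close>

text \<open>The two assumptions say that the antinorm equals the norm. At \<open>a = 0\<close>,
  \<open>attain\<close> still supplies a unit vector.\<close>

locale radon_form = area_form +
  assumes le: "w a b \<le> norm a * norm b"
    and attain: "\<exists>b. norm b = 1 \<and> w a b = norm a"

text \<open>Compactness of the sphere yields the maximisers \<open>B a\<close>; dividing by the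
  positive proportionality factor \<open>k\<close> makes the antinorm equal to the norm.\<close>

lemma radon_plane_imp_radon_form:
  assumes radon: "radon_plane TYPE('a::real_normed_vector)"
  obtains w :: "'a::real_normed_vector \<Rightarrow> 'a \<Rightarrow> real" where "radon_form w"
proof -
  obtain w :: "'a \<Rightarrow> 'a \<Rightarrow> real" where w: "area_form w" "\<And>a. a \<noteq> 0 \<Longrightarrow> \<exists>b. w a b \<noteq> 0"
    using radon_plane_imp_area_form[OF radon] by blast
  interpret area_form w by fact
  obtain g :: "real \<times> real \<Rightarrow> 'a" where g: "linear g" "bij g"
    using dim_2_coordinates radon unfolding radon_plane_def by blast
  define e where "e = g (1, 0)"
  have e: "e \<noteq> 0"
    using g linear_injective_0[OF g(1)] by (fastforce simp: e_def bij_def zero_prod_def)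
  have "\<exists>b. norm b = 1 \<and> (\<forall>c. w a c \<le> w a b * norm c)" for a
  proof -
    have "\<exists>b\<in>sphere 0 1. \<forall>c\<in>sphere 0 1. w a c \<le> w a b"
    proof (rule continuous_attains_sup)
      have "e /\<^sub>R norm e \<in> sphere 0 1" using e by simp
      then show "sphere (0::'a) 1 \<noteq> {}" by blast
      show "continuous_on (sphere 0 1) (w a)"
        using bilinear by (intro radon_plane_linear_continuous[OF radon]) (auto simp: bilinear_def)
    qed (rule radon_plane_compact_sphere[OF radon])
    then obtain b where b: "norm b = 1" "\<And>c. norm c = 1 \<Longrightarrow> w a c \<le> w a b" by auto
    have "w a c \<le> w a b * norm c" for c
    proof (cases "c = 0")
      case True then show ?thesis using w_simps(6)[of a 0 0] by simp
    next
      case False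
      then have "w a (c /\<^sub>R norm c) \<le> w a b" by (intro b(2)) simp
      with False show ?thesis by (simp add: w_simps field_simps)
    qed
    with b show ?thesis by blast
  qed
  then obtain B where B: "\<And>a. norm (B a) = 1" "\<And>a c. w a c \<le> w a (B a) * norm c" by metis
  define k where "k = w e (B e) / norm e"
  have k: "w a (B a) = k * norm a" for a
  proof (cases "a = 0")
    case True then show ?thesis using w_simps(5)[of 0 0 "B 0"] by simp
  next
    case False
    then have "w a (B a) / norm a = k"
      unfolding k_def using radon w B e by (intro radon_antinorm_proportional) auto
    with False show ?thesis by (simp add: field_simps)
  qed
  have "k > 0"
  proof -
    obtain b where "w e b \<noteq> 0" using w(2)[OF e] by blast
    then have "0 < w e b \<or> 0 < w e (- b)" by (auto simp: w_simps)
    then have "0 < k * (norm e * norm b)" using B(2)[of e b] B(2)[of e "- b"] by (auto simp: k algebra_simps)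
    moreover have "0 \<le> norm e * norm b" by simp
    ultimately show ?thesis using zero_less_mult_pos2[of k "norm e * norm b"] by (metis less_eq_real_def mult_zero_right)
  qed
  have "radon_form (\<lambda>a b. w a b / k)"
  proof
    show "bilinear (\<lambda>a b. w a b / k)"
      unfolding bilinear_def by (intro allI conjI linearI) (auto simp: w_simps add_divide_distrib)
    show "(w a b / k) *\<^sub>R c = (w c b / k) *\<^sub>R a + (w a c / k) *\<^sub>R b" for a b c
      using arg_cong[OF expand[of a b c], of "scaleR (1 / k)"] by (simp add: algebra_simps)
    show "w a b / k \<le> norm a * norm b" for a b
      using B(2)[of a b] \<open>k > 0\<close> by (simp add: k field_simps)
    show "\<exists>b. norm b = 1 \<and> w a b / k = norm a" for a
      using B(1)[of a] k[of a] \<open>k > 0\<close> by (intro exI[of _ "B a"]) simp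
  qed simp
  then show ?thesis using that by blast
qed

context radon_form
begin

lemma abs_le: "\<bar>w a b\<bar> \<le> norm a * norm b"
  using le[of a b] le[of "- a" b] by (simp add: w_simps)

text \<open>If \<open>c\<close> attains the norm of \<open>y\<close>, its
  \<open>x\<close>-coordinate is \<open>1 / w x y\<close> up to sign, and orthogonality bounds that
  coordinate by \<open>norm c = 1\<close>.\<close>

lemma orthogonal_imp_abs_eq_1:
  assumes "norm x = 1" "norm y = 1" "x \<bottom>\<^sub>B y"
  shows "\<bar>w x y\<bar> = 1"
proof -
  obtain c where c: "norm c = 1" "w y c = 1" using attain[of y] assms by auto
  have "\<bar>w c y\<bar> * norm x \<le> norm (w c y *\<^sub>R x + w x c *\<^sub>R y)"
    by (rule bj_orthogonal_scaleR) fact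
  also have "w c y *\<^sub>R x + w x c *\<^sub>R y = w x y *\<^sub>R c" by (rule expand[symmetric])
  finally have "1 \<le> \<bar>w x y\<bar>" using c assms skew[of c y] by simp
  then show ?thesis using abs_le[of x y] assms by simp
qed

lemma orthogonalI:
  assumes "norm x = 1" "norm y = 1" "w x y = 1"
  shows "x \<bottom>\<^sub>B y"
  using le[of "x + l *\<^sub>R y" y for l] assms by (simp add: bj_orthogonal_def w_simps)

text \<open>Pairing with \<open>v\<close>, \<open>u\<close> and \<open>u + v\<close> reads off
  \<open>a\<close>, \<open>- b\<close> and \<open>a - b\<close>, which bounds the norm below;
  splitting into two adjacent unit vertices bounds it above.\<close>

lemma hexagon_norm:
  assumes "norm u = 1" "norm v = 1" "norm (u + v) = 1" "w u v = 1"
  shows "norm (a *\<^sub>R u + b *\<^sub>R v) = hexnorm a b"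
proof (rule antisym)
  let ?z = "a *\<^sub>R u + b *\<^sub>R v"
  have vu: "w v u = -1" using skew[of v u] assms by simp
  show "hexnorm a b \<le> norm ?z"
    using abs_le[of ?z v] abs_le[of ?z u] abs_le[of ?z "u + v"] assms vu
    by (simp add: hexnorm_def w_simps)
  obtain s t p1 p2 q1 q2 where *: "0 \<le> s" "0 \<le> t" "s + t = hexnorm a b"
    "a = s * p1 + t * q1" "b = s * p2 + t * q2"
    and pq: "(p1, p2) \<in> {(1, 0), (0, 1), (1, 1), (-1, 0), (0, -1), (-1, -1)}"
    "(q1, q2) \<in> {(1, 0), (0, 1), (1, 1), (-1, 0), (0, -1), (-1, -1)}"
    by (rule hexnorm_decompose)
  have "norm (- u - v) = 1" using assms(3) norm_minus_cancel[of "u + v"] by simp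
  then have n: "norm (p1 *\<^sub>R u + p2 *\<^sub>R v) = 1" "norm (q1 *\<^sub>R u + q2 *\<^sub>R v) = 1"
    using pq assms by auto
  have "?z = s *\<^sub>R (p1 *\<^sub>R u + p2 *\<^sub>R v) + t *\<^sub>R (q1 *\<^sub>R u + q2 *\<^sub>R v)"
    by (simp add: * algebra_simps)
  then have "norm ?z \<le> norm (s *\<^sub>R (p1 *\<^sub>R u + p2 *\<^sub>R v)) + norm (t *\<^sub>R (q1 *\<^sub>R u + q2 *\<^sub>R v))"
    by (metis norm_triangle_ineq)
  then show "norm ?z \<le> hexnorm a b"
    using n * by simp
qed

lemma norm_sum_add_norm_diff_area_1:
  assumes xy: "norm x = 1" "norm y = 1" "w x y = 1"
  shows "norm (x + y) + norm (x - y) \<le> 3"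
    and "norm (x + y) + norm (x - y) = 3 \<Longrightarrow>
      \<exists>u v. norm u = 1 \<and> norm v = 1 \<and> norm (u + v) = 1 \<and> w u v = 1"
proof -
  obtain z where z: "norm z = 1" "w (x + y) z = norm (x + y)" using attain by blast
  obtain v where v: "norm v = 1" "w (x - y) v = norm (x - y)" using attain by blast
  define b A d c where "b = w x z" and "A = w y z" and "d = w x v" and "c = - w y v"
  have bounds: "b \<le> 1" "A \<le> 1" "d \<le> 1" "c \<le> 1"
    using abs_le[of x z] abs_le[of y z] abs_le[of x v] abs_le[of y v] xy z v
    by (auto simp: b_def A_def c_def d_def)
  have sums: "norm (x + y) = b + A" "norm (x - y) = c + d"
    using z v by (auto simp: b_def A_def c_def d_def w_simps)
  have zexp: "z = (- A) *\<^sub>R x + b *\<^sub>R y" and vexp: "v = c *\<^sub>R x + d *\<^sub>R y"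
    using expand[of x y z] expand[of x y v] xy skew[of z y] skew[of v y]
    by (auto simp: b_def A_def c_def d_def)
  have vz: "w v z = c * b + d * A"
    by (subst vexp) (simp add: w_simps b_def A_def)
  then have "c * b + d * A \<le> 1" using le[of v z] v z by simp
  moreover have id: "c * b + d * A = (b + A + c + d - 2) + ((1 - c) * (1 - b) + (1 - d) * (1 - A))"
    by (simp add: algebra_simps)
  moreover have nn: "0 \<le> (1 - c) * (1 - b)" "0 \<le> (1 - d) * (1 - A)" using bounds by auto
  ultimately show "norm (x + y) + norm (x - y) \<le> 3" by (simp add: sums)
  assume eq: "norm (x + y) + norm (x - y) = 3"
  then have zero: "(1 - c) * (1 - b) = 0" "(1 - d) * (1 - A) = 0"
    using \<open>c * b + d * A \<le> 1\<close> id nn sums by linarith+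
  then have vz1: "w v z = 1" using vz id sums eq by linarith
  \<comment> \<open>In each case the coordinates of \<open>z\<close> and \<open>v\<close> exhibit
    one unit vector among \<open>x\<close>, \<open>y\<close>, \<open>z\<close>, \<open>v\<close> as
    the sum of two others.\<close>
  from zero consider "c = 1" "d = 1" | "c = 1" "A = 1" | "b = 1" "d = 1" | "b = 1" "A = 1" by fastforce
  then show "\<exists>u v. norm u = 1 \<and> norm v = 1 \<and> norm (u + v) = 1 \<and> w u v = 1"
  proof cases
    case 1
    then have "x + y = v" using vexp by simp
    with xy v show ?thesis by blast
  next
    case 2
    then have "d + b = 1" using eq sums by simp
    then have "v + z = y" using 2 by (simp add: vexp zexp flip: scaleR_add_left)
    with xy v z vz1 show ?thesis by blast
  next
    case 3
    then have "c = 1 - A" using eq sums by simp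
    then have "x + z = v" using 3 by (simp add: vexp zexp scaleR_left_diff_distrib)
    with xy v z 3 show ?thesis unfolding b_def by blast
  next
    case 4
    then have "x + z = y" by (simp add: zexp)
    with xy z 4 show ?thesis unfolding b_def by blast
  qed
qed

lemma norm_sum_add_norm_diff:
  fixes x y :: 'a
  assumes xy: "norm x = 1" "norm y = 1" "x \<bottom>\<^sub>B y"
  shows "norm (x + y) + norm (x - y) \<le> 3"
    and "norm (x + y) + norm (x - y) = 3 \<Longrightarrow>
      \<exists>u v. norm u = 1 \<and> norm v = 1 \<and> norm (u + v) = 1 \<and> w u v = 1"
proof -
  \<comment> \<open>Replacing \<open>y\<close> by \<open>- y\<close> only exchanges the two
    norms.\<close>
  have "w x y = 1 \<or> w x (- y) = 1" using orthogonal_imp_abs_eq_1[OF xy] by (auto simp: w_simps)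
  then show "norm (x + y) + norm (x - y) \<le> 3" "norm (x + y) + norm (x - y) = 3 \<Longrightarrow>
      \<exists>u v. norm u = 1 \<and> norm v = 1 \<and> norm (u + v) = 1 \<and> w u v = 1"
    using norm_sum_add_norm_diff_area_1[of x y] norm_sum_add_norm_diff_area_1[of x "- y"] xy by auto
qed

end

section \<open>The ratio for the arithmetic mean and its maximum\<close>

lemma arith_mean_le:
  fixes x y :: "'a::real_normed_vector"
  assumes "norm x = 1" "0 \<le> \<tau>" "\<tau> \<le> 1"
  shows "(norm (x + \<tau> *\<^sub>R y) + norm (x - \<tau> *\<^sub>R y)) / 2
      \<le> 1 - \<tau> + \<tau> * ((norm (x + y) + norm (x - y)) / 2)"
proof -
  have "x + \<tau> *\<^sub>R y = (1 - \<tau>) *\<^sub>R x + \<tau> *\<^sub>R (x + y)" "x - \<tau> *\<^sub>R y = (1 - \<tau>) *\<^sub>R x + \<tau> *\<^sub>R (x - y)"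
    by (simp_all add: algebra_simps)
  then have "norm (x + \<tau> *\<^sub>R y) \<le> (1 - \<tau>) + \<tau> * norm (x + y)" "norm (x - \<tau> *\<^sub>R y) \<le> (1 - \<tau>) + \<tau> * norm (x - y)"
    using assms norm_triangle_ineq[of "(1 - \<tau>) *\<^sub>R x" "\<tau> *\<^sub>R (x + y)"]
      norm_triangle_ineq[of "(1 - \<tau>) *\<^sub>R x" "\<tau> *\<^sub>R (x - y)"] by simp_all
  then show ?thesis by (simp add: field_simps)
qed

text \<open>The case \<open>t = 1\<close> before the suprema are taken. It dominates every
  \<open>t \<le> 1\<close> on orthogonal unit vectors and is jointly continuous.\<close>

definition mean_ratio :: "real \<Rightarrow> 'a::real_normed_vector \<Rightarrow> 'a \<Rightarrow> real"
  where "mean_ratio \<tau> x y = ((norm (x + \<tau> *\<^sub>R y) + norm (x - \<tau> *\<^sub>R y)) / 2)\<^sup>2 / (1 + \<tau>\<^sup>2)"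

context radon_form
begin

lemma mean_ratio_bound:
  fixes x y :: 'a
  assumes xy: "norm x = 1" "norm y = 1" "x \<bottom>\<^sub>B y" and \<tau>: "0 \<le> \<tau>" "\<tau> \<le> 1"
  shows "mean_ratio \<tau> x y \<le> 5 / 4"
    and "mean_ratio \<tau> x y = 5 / 4 \<Longrightarrow> norm (x + y) + norm (x - y) = 3"
proof -
  define S where "S = norm (x + y) + norm (x - y)"
  define m where "m = (norm (x + \<tau> *\<^sub>R y) + norm (x - \<tau> *\<^sub>R y)) / 2"
  have S: "S \<le> 3" using norm_sum_add_norm_diff(1)[OF xy] by (simp add: S_def)
  have m: "m \<le> 1 - \<tau> + \<tau> * (S / 2)" using arith_mean_le[OF xy(1) \<tau>, of y] by (simp add: m_def S_def)
  also have "\<dots> \<le> 1 - \<tau> + \<tau> * (3 / 2)" using S \<tau> by (intro add_left_mono mult_left_mono) auto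
  finally have m1: "m \<le> 1 + \<tau> / 2" by simp
  have m0: "m \<ge> 0" by (simp add: m_def)
  have id: "(1 + \<tau> / 2)\<^sup>2 + (\<tau> - 1 / 2)\<^sup>2 = 5 / 4 * (1 + \<tau>\<^sup>2)"
    by (simp add: power2_eq_square algebra_simps)
  have sq: "m\<^sup>2 \<le> (1 + \<tau> / 2)\<^sup>2" using m1 m0 by (intro power_mono) auto
  then have "m\<^sup>2 \<le> 5 / 4 * (1 + \<tau>\<^sup>2)" using id zero_le_power2[of "\<tau> - 1 / 2"] by linarith
  moreover have pos: "1 + \<tau>\<^sup>2 > 0" by (simp add: add_pos_nonneg)
  ultimately show "mean_ratio \<tau> x y \<le> 5 / 4"
    unfolding mean_ratio_def m_def[symmetric] by (subst pos_divide_le_eq) auto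
  assume "mean_ratio \<tau> x y = 5 / 4"
  then have eq: "m\<^sup>2 = 5 / 4 * (1 + \<tau>\<^sup>2)"
    using pos unfolding mean_ratio_def m_def[symmetric] by (simp add: field_simps)
  then have zero: "(\<tau> - 1 / 2)\<^sup>2 \<le> 0" using id sq by linarith
  then have half: "\<tau> = 1 / 2" by simp
  have "m\<^sup>2 = (1 + \<tau> / 2)\<^sup>2" using eq id zero zero_le_power2[of "\<tau> - 1 / 2"] by linarith
  then have "m = 1 + \<tau> / 2" using m0 \<tau> by (simp add: power2_eq_iff_nonneg)
  \<comment> \<open>At \<open>\<tau> = 1 / 2\<close> the convexity bound reads
    \<open>5 / 4 \<le> 1 / 2 + S / 4\<close>.\<close>
  then have "S = 3" using m S half by simp
  then show "norm (x + y) + norm (x - y) = 3" by (simp add: S_def)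
qed

end

text \<open>Orthogonality is a closed condition, so the admissible triples form a compact set. An
  attained maximum lets the equality case speak of actual vectors, not of a limit.\<close>

lemma mean_ratio_attains_max:
  assumes radon: "radon_plane TYPE('a::real_normed_vector)"
  obtains \<tau> and x y :: "'a::real_normed_vector"
  where "0 \<le> \<tau>" "\<tau> \<le> 1" "norm x = 1" "norm y = 1" "x \<bottom>\<^sub>B y"
    "\<And>\<sigma> a b :: 'a. 0 \<le> \<sigma> \<Longrightarrow> \<sigma> \<le> 1 \<Longrightarrow> norm a = 1 \<Longrightarrow> norm b = 1 \<Longrightarrow> a \<bottom>\<^sub>B b \<Longrightarrow>
      mean_ratio \<sigma> a b \<le> mean_ratio \<tau> x y"
proof -
  obtain w :: "'a \<Rightarrow> 'a \<Rightarrow> real" where "radon_form w"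
    using radon_plane_imp_radon_form[OF radon] by blast
  then interpret radon_form w .
  define K where "K = {0..1::real} \<times> ((sphere 0 1 \<times> sphere 0 1) \<inter> {p :: 'a \<times> 'a. fst p \<bottom>\<^sub>B snd p})"
  have "closed {p :: 'a \<times> 'a. fst p \<bottom>\<^sub>B snd p}"
    unfolding bj_orthogonal_def by (intro closed_Collect_all closed_Collect_le continuous_intros)
  then have "compact K"
    unfolding K_def by (intro compact_Times compact_Int_closed radon_plane_compact_sphere[OF radon]) auto
  moreover obtain e :: 'a where "norm e = 1" using attain by blast
  then obtain b where "norm b = 1" "w e b = 1" using attain by metis
  then have "(0, e, b) \<in> K" using orthogonalI \<open>norm e = 1\<close> by (simp add: K_def)
  then have "K \<noteq> {}" by blast
  moreover have "continuous_on K (\<lambda>(\<tau>, x, y). mean_ratio \<tau> x y)"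
    unfolding mean_ratio_def case_prod_beta
    by (intro continuous_intros) (auto simp: power2_eq_square add_nonneg_eq_0_iff)
  ultimately obtain p where "p \<in> K" "\<forall>q\<in>K. (\<lambda>(\<tau>, x, y). mean_ratio \<tau> x y) q \<le> (\<lambda>(\<tau>, x, y). mean_ratio \<tau> x y) p"
    using continuous_attains_sup by blast
  then show ?thesis
    by (intro that[of "fst p" "fst (snd p)" "snd (snd p)"]) (force simp: K_def case_prod_beta)+
qed

section \<open>The suprema \<open>J_B\<close> and \<open>C_B\<close>\<close>

text \<open>The power mean is at most the arithmetic mean, so \<open>B\<close> bounds the set under
  the supremum; the given pair makes this set nonempty.\<close>

lemma J_B_bounds:
  assumes ne: "x \<in> sphere (0::'a::real_normed_vector) 1" "y \<in> sphere (0::'a) 1" "x \<bottom>\<^sub>B y"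
    and t: "t \<le> 1"
    and bound: "\<And>x y :: 'a. norm x = 1 \<Longrightarrow> norm y = 1 \<Longrightarrow> x \<bottom>\<^sub>B y \<Longrightarrow> mean_ratio \<tau> x y \<le> B"
  shows "power_mean t (norm (x + \<tau> *\<^sub>R y)) (norm (x - \<tau> *\<^sub>R y)) \<le> J_B TYPE('a) t \<tau>"
    and "(J_B TYPE('a) t \<tau>)\<^sup>2 / (1 + \<tau>\<^sup>2) \<le> B"
proof -
  define P where "P = {power_mean t (norm (x + \<tau> *\<^sub>R y)) (norm (x - \<tau> *\<^sub>R y)) | x y :: 'a.
           x \<in> sphere 0 1 \<and> y \<in> sphere 0 1 \<and> x \<bottom>\<^sub>B y}"
  have J: "J_B TYPE('a) t \<tau> = Sup P" by (simp add: J_B_def P_def)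
  have pos: "1 + \<tau>\<^sup>2 > 0" by (simp add: add_pos_nonneg)
  have le: "p \<le> sqrt (B * (1 + \<tau>\<^sup>2))" "0 \<le> p" if p_in: "p \<in> P" for p
  proof -
    obtain x y :: 'a where xy: "norm x = 1" "norm y = 1" "x \<bottom>\<^sub>B y"
      and p: "p = power_mean t (norm (x + \<tau> *\<^sub>R y)) (norm (x - \<tau> *\<^sub>R y))"
      using p_in unfolding P_def by auto
    show "0 \<le> p" by (simp add: p power_mean_nonneg)
    have ge: "1 \<le> norm (x + \<tau> *\<^sub>R y)" "1 \<le> norm (x - \<tau> *\<^sub>R y)"
      using xy(1) xy(3)[unfolded bj_orthogonal_def, rule_format, of \<tau>]
        xy(3)[unfolded bj_orthogonal_def, rule_format, of "- \<tau>"] by auto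
    then have "p \<le> (norm (x + \<tau> *\<^sub>R y) + norm (x - \<tau> *\<^sub>R y)) / 2"
      unfolding p by (intro power_mean_le_arith_mean t) auto
    also have "\<dots> \<le> sqrt (B * (1 + \<tau>\<^sup>2))"
      using bound[OF xy] pos by (intro real_le_rsqrt) (simp add: mean_ratio_def pos_divide_le_eq)
    finally show "p \<le> sqrt (B * (1 + \<tau>\<^sup>2))" .
  qed
  let ?p = "power_mean t (norm (x + \<tau> *\<^sub>R y)) (norm (x - \<tau> *\<^sub>R y))"
  have mem: "?p \<in> P" using ne unfolding P_def by blast
  moreover have "bdd_above P" using le(1) by (auto simp: bdd_above_def)
  ultimately show up: "?p \<le> J_B TYPE('a) t \<tau>" unfolding J by (rule cSup_upper)
  have J0: "0 \<le> J_B TYPE('a) t \<tau>" using up le(2)[OF mem] by linarith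
  have J1: "J_B TYPE('a) t \<tau> \<le> sqrt (B * (1 + \<tau>\<^sup>2))"
    unfolding J using mem le(1) by (intro cSup_least) auto
  \<comment> \<open>\<open>sqrt\<close> is odd on the reals, so the sign of its argument has to be
    known before squaring removes it.\<close>
  have "0 \<le> B * (1 + \<tau>\<^sup>2)" using J0 J1 real_sqrt_ge_0_iff order_trans by blast
  then have "(J_B TYPE('a) t \<tau>)\<^sup>2 \<le> B * (1 + \<tau>\<^sup>2)"
    using power_mono[OF J1 J0, of 2] by simp
  then show "(J_B TYPE('a) t \<tau>)\<^sup>2 / (1 + \<tau>\<^sup>2) \<le> B" using pos by (simp add: pos_divide_le_eq)
qed

theorem theorem16:
  fixes t :: ereal
  assumes "radon_plane TYPE('a::real_normed_vector)"
    and "-\<infinity> \<le> t" and "t \<le> 1"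
  shows "C_B TYPE('a) t \<le> 5 / 4 \<and>
    (C_B TYPE('a) t = 5 / 4 \<longleftrightarrow> affine_regular_hexagon (sphere (0::'a) 1))"
proof -
  obtain w :: "'a \<Rightarrow> 'a \<Rightarrow> real" where "radon_form w"
    using radon_plane_imp_radon_form[OF assms(1)] by blast
  then interpret radon_form w .
  obtain \<tau> and x y :: 'a where \<tau>: "0 \<le> \<tau>" "\<tau> \<le> 1" and xy: "norm x = 1" "norm y = 1" "x \<bottom>\<^sub>B y"
    and max: "\<And>\<sigma> a b :: 'a. 0 \<le> \<sigma> \<Longrightarrow> \<sigma> \<le> 1 \<Longrightarrow> norm a = 1 \<Longrightarrow> norm b = 1 \<Longrightarrow> a \<bottom>\<^sub>B b \<Longrightarrow>
      mean_ratio \<sigma> a b \<le> mean_ratio \<tau> x y"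
    using mean_ratio_attains_max[OF assms(1)] by blast
  have J_le: "(J_B TYPE('a) t \<sigma>)\<^sup>2 / (1 + \<sigma>\<^sup>2) \<le> mean_ratio \<tau> x y" if "\<sigma> \<in> {0..1}" for \<sigma>
    using that xy assms(3) max by (intro J_B_bounds(2)[of x y]) auto
  have C_le: "C_B TYPE('a) t \<le> mean_ratio \<tau> x y"
    unfolding C_B_def by (rule cSUP_least) (auto simp: J_le)
  have ratio: "mean_ratio \<tau> x y \<le> 5 / 4" by (rule mean_ratio_bound(1)[OF xy \<tau>])
  have hexagon: "affine_regular_hexagon (sphere (0::'a) 1)" if "C_B TYPE('a) t = 5 / 4"
  proof -
    have "mean_ratio \<tau> x y = 5 / 4" using that C_le ratio by simp
    then have "norm (x + y) + norm (x - y) = 3" by (rule mean_ratio_bound(2)[OF xy \<tau>])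
    then obtain u v where uv: "norm u = 1" "norm v = 1" "norm (u + v) = 1" "w u v = 1"
      using norm_sum_add_norm_diff(2)[OF xy] by blast
    then have "z = w z v *\<^sub>R u + w u z *\<^sub>R v" for z using expand[of u v z] by simp
    then show ?thesis
      using hexagon_norm[OF uv] hexagonal_norm_imp_affine_regular_hexagon by blast
  qed
  have "5 / 4 \<le> C_B TYPE('a) t" if hex: "affine_regular_hexagon (sphere (0::'a) 1)"
  proof -
    obtain u v :: 'a where uv: "\<And>a b. norm (a *\<^sub>R u + b *\<^sub>R v) = hexnorm a b"
      using affine_regular_hexagon_imp_hexagonal_norm[OF hex] by blast
    \<comment> \<open>The midpoint of the side from \<open>u\<close> to \<open>u + v\<close>, which
      is parallel to \<open>v\<close>. The vectors \<open>v + e / 2\<close> and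
      \<open>v - e / 2\<close> have equal norms, so the value of the mean is the same for all
      \<open>t\<close>.\<close>
    define e where "e = u + (1 / 2) *\<^sub>R v"
    have comb: "norm (a *\<^sub>R v + b *\<^sub>R e) = hexnorm b (a + b / 2)" for a b
      using uv[of b "a + b / 2"] by (simp add: e_def algebra_simps)
    have v: "norm v = 1" and e: "norm e = 1" 
      using comb[of 1 0] comb[of 0 1] by (simp_all add: hexnorm_def)
    have orth: "v \<bottom>\<^sub>B e"
      unfolding bj_orthogonal_def v using comb[of 1] by (auto simp: hexnorm_def)
    have n: "norm (v + (1 / 2) *\<^sub>R e) = 5 / 4" "norm (v - (1 / 2) *\<^sub>R e) = 5 / 4"
      using comb[of 1 "1 / 2"] comb[of 1 "- 1 / 2"] by (simp_all add: hexnorm_def)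
    have "power_mean t (norm (v + (1 / 2) *\<^sub>R e)) (norm (v - (1 / 2) *\<^sub>R e)) \<le> J_B TYPE('a) t (1 / 2)"
      using v e orth assms(3) max by (intro J_B_bounds(1)[where B = "mean_ratio \<tau> x y"]) auto
    then have "5 / 4 \<le> J_B TYPE('a) t (1 / 2)" by (simp add: n power_mean_same)
    then have "(5 / 4)\<^sup>2 \<le> (J_B TYPE('a) t (1 / 2))\<^sup>2" by (intro power_mono) auto
    \<comment> \<open>The square of 5/4 divided by 1 + 1/4 is again 5/4.\<close>
    then have "5 / 4 \<le> (J_B TYPE('a) t (1 / 2))\<^sup>2 / (1 + (1 / 2)\<^sup>2)"
      by (simp add: power2_eq_square)
    also have "\<dots> \<le> C_B TYPE('a) t"
      unfolding C_B_def
      by (intro cSUP_upper bdd_aboveI2[of _ _ "mean_ratio \<tau> x y"] J_le) auto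
    finally show ?thesis .
  qed
  with hexagon C_le ratio show ?thesis by fastforce
qed

end
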